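(* Let $T$ be a consistent, recursively enumerable $\mathcal{L}$-theory extending $\mathsf{R}$, and let $T^{\vdash}$ be its set of theorems. There exists a numbering $\alpha\colon A^\ast\to\mathbb{N}$ such that, for every $s\in A^\ast$, $\alpha(s)$ is even if and only if $s\in T^{\vdash}$, and such that the formula $\mathsf{Pr}^\alpha(x)\equiv\exists y<x\; x=\overline{2}\times y$ binumerates $\alpha(T^{\vdash})$ in $\mathsf{R}$, satisfies Löb$(T,\alpha)$, and $T\vdash\neg\mathsf{Pr}^\alpha(\ulcorner\bot\urcorner^\alpha)$.
   Context: Language: $\mathcal{L}$ is the first-order arithmetical language with symbols $\mathsf{0},\mathsf{S},+,\times,=,\neg,\wedge,\forall$. The finite alphabet $A$ consists of these symbols together with $\mathsf{v}$, $\prime$, $($ and $)$. $A^\ast$ is the set of nonempty finite strings over $A$. Variables are $\mathsf{v}$ followed by finitely many strokes; terms and formulae are the usual well-formed (fully parenthesised, infix) strings in $A^\ast$. Other logical symbols are the usual abbreviations; $x\le y$ abbreviates $\exists z\, z+x=y$ and $x<y$ abbreviates $x\le y\wedge x\ne y$. $\overline{n}$ is the standard numeral of $n$. A numbering of $A^\ast$ is an injective function $\alpha\colon A^\ast\to\mathbb{N}$ (no computability required). $\ulcorner\phi\urcorner^{\alpha}$ is the numeral $\overline{\alpha(\phi)}$. The theory $\mathsf{R}$ has the axiom schemata (for all $m,n\in\mathbb{N}$): $\overline{m}+\overline{n}=\overline{m+n}$; $\overline{m}\times\overline{n}=\overline{m\cdot n}$; $\overline{m}\neq\overline{n}$ for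 $m\ne n$; $x\le\overline{n}\to\bigvee_{k\le n}x=\overline{k}$; $x\le\overline{n}\vee\overline{n}\le x$. A formula $\phi(x)$ binumerates $X\subseteq\mathbb{N}$ in $\mathsf{R}$ if $\mathsf{R}\vdash\phi(\overline{n})$ for $n\in X$ and $\mathsf{R}\vdash\neg\phi(\overline{n})$ for $n\notin X$. A formula $\mathsf{Pr}^\alpha(x)$ satisfies Löb$(T,\alpha)$ if for all sentences $\phi,\psi$: (1) $T\vdash\phi$ implies $T\vdash\mathsf{Pr}^\alpha(\ulcorner\phi\urcorner^\alpha)$; (2) $T\vdash\mathsf{Pr}^\alpha(\ulcorner\phi\urcorner^\alpha)\wedge\mathsf{Pr}^\alpha(\ulcorner\phi\to\psi\urcorner^\alpha)\to\mathsf{Pr}^\alpha(\ulcorner\psi\urcorner^\alpha)$; (3) $T\vdash\mathsf{Pr}^\alpha(\ulcorner\phi\urcorner^\alpha)\to\mathsf{Pr}^\alpha(\ulcorner\mathsf{Pr}^\alpha(\ulcorner\phi\urcorner^\alpha)\urcorner^\alpha)$. $\bot$ is a fixed sentence refutable in $T$, such as $\mathsf{0}=\mathsf{S0}$. *)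

theory Defs
  imports Main
begin

datatype sym = SZero | SSucc | SPlus | STimes | SEq | SNot | SAnd | SAll
  | SVar | SPrime | SLpar | SRpar

definition Astar :: "sym list set" where
  "Astar = {s. s \<noteq> []}"

datatype tm = Var nat | Zero | Succ tm | Add tm tm | Mul tm tm

datatype fm = Eq tm tm | Neg fm | Conj fm fm | Forall nat fm

text \<open>
  Syntax trees stand for the well-formed strings that they are written as by the next two
  functions; the lemma \<open>str_fm_inject\<close> below (unique readability) justifies this.
\<close>

primrec str_tm :: "tm \<Rightarrow> sym list" where
  "str_tm (Var n) = SVar # replicate n SPrime"
| "str_tm Zero = [SZero]"
| "str_tm (Succ t) = SSucc # str_tm t"
| "str_tm (Add t u) = SLpar # str_tm t @ SPlus # str_tm u @ [SRpar]"
| "str_tm (Mul t u) = SLpar # str_tm t @ STimes # str_tm u @ [SRpar]"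

primrec str_fm :: "fm \<Rightarrow> sym list" where
  "str_fm (Eq t u) = SLpar # str_tm t @ SEq # str_tm u @ [SRpar]"
| "str_fm (Neg p) = SNot # str_fm p"
| "str_fm (Conj p q) = SLpar # str_fm p @ SAnd # str_fm q @ [SRpar]"
| "str_fm (Forall x p) = SAll # str_tm (Var x) @ str_fm p"

lemma str_fm_in_Astar: "str_fm p \<in> Astar"
  by (cases p) (auto simp: Astar_def)

definition noprime :: "sym list \<Rightarrow> bool" where
  "noprime r \<longleftrightarrow> (\<forall>r'. r \<noteq> SPrime # r')"

lemma noprime_simps [simp]:
  "noprime []" "noprime (a # r) \<longleftrightarrow> a \<noteq> SPrime"
  by (auto simp: noprime_def)

lemma replicate_prime_cancel:
  "replicate m SPrime @ r = replicate n SPrime @ r' \<Longrightarrow> noprime r \<Longrightarrow> noprime r'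
    \<Longrightarrow> m = n \<and> r = r'"
proof (induction m arbitrary: n)
  case 0
  then show ?case by (cases n) simp_all
next
  case (Suc m)
  then show ?case by (cases n) auto
qed

lemma str_tm_prefix:
  "str_tm t @ r = str_tm u @ r' \<Longrightarrow> noprime r \<Longrightarrow> noprime r' \<Longrightarrow> t = u \<and> r = r'"
proof (induction t arbitrary: u r r')
  case (Var n)
  then show ?case
    using replicate_prime_cancel[of n r _ r'] by (cases u) simp_all
next
  case Zero
  then show ?case by (cases u) simp_all
next
  case (Succ t)
  show ?case
  proof (cases u)
    case (Succ u1)
    then show ?thesis using Succ.IH[of r u1 r'] Succ.prems by simp
  qed (use Succ.prems in simp_all)
next
  case (Add t1 t2)
  show ?case
  proof (cases u)
    case (Add u1 u2)
    with Add.IH(1)[of "SPlus # str_tm t2 @ SRpar # r" u1 "SPlus # str_tm u2 @ SRpar # r'"]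
      Add.IH(2)[of "SRpar # r" u2 "SRpar # r'"] Add.prems
    show ?thesis by simp
  next
    case (Mul u1 u2)
    with Add.IH(1)[of "SPlus # str_tm t2 @ SRpar # r" u1 "STimes # str_tm u2 @ SRpar # r'"]
      Add.prems
    show ?thesis by simp
  qed (use Add.prems in simp_all)
next
  case (Mul t1 t2)
  show ?case
  proof (cases u)
    case (Mul u1 u2)
    with Mul.IH(1)[of "STimes # str_tm t2 @ SRpar # r" u1 "STimes # str_tm u2 @ SRpar # r'"]
      Mul.IH(2)[of "SRpar # r" u2 "SRpar # r'"] Mul.prems
    show ?thesis by simp
  next
    case (Add u1 u2)
    with Mul.IH(1)[of "STimes # str_tm t2 @ SRpar # r" u1 "SPlus # str_tm u2 @ SRpar # r'"]
      Mul.prems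
    show ?thesis by simp
  qed (use Mul.prems in simp_all)
qed

lemma str_tm_neq_str_fm: "str_tm t @ r \<noteq> str_fm p @ r'"
proof (induction t arbitrary: p r r')
  case (Add t1 t2)
  show ?case
  proof (cases p)
    case (Eq u1 u2)
    with str_tm_prefix[of t1 "SPlus # str_tm t2 @ SRpar # r" u1 "SEq # str_tm u2 @ SRpar # r'"]
    show ?thesis by auto
  qed (use Add.IH(1) in simp_all)
next
  case (Mul t1 t2)
  show ?case
  proof (cases p)
    case (Eq u1 u2)
    with str_tm_prefix[of t1 "STimes # str_tm t2 @ SRpar # r" u1 "SEq # str_tm u2 @ SRpar # r'"]
    show ?thesis by auto
  qed (use Mul.IH(1) in simp_all)
qed (case_tac p; simp)+

lemma noprime_str_fm: "noprime (str_fm p @ r)"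
  by (cases p) simp_all

lemma str_fm_prefix: "str_fm p @ r = str_fm q @ r' \<Longrightarrow> p = q \<and> r = r'"
proof (induction p arbitrary: q r r')
  case (Eq t u)
  show ?case
  proof (cases q)
    case (Eq t' u')
    with Eq.prems str_tm_prefix[of t "SEq # str_tm u @ SRpar # r" t' "SEq # str_tm u' @ SRpar # r'"]
      str_tm_prefix[of u "SRpar # r" u' "SRpar # r'"]
    show ?thesis by simp
  qed (use Eq.prems in \<open>simp_all add: str_tm_neq_str_fm\<close>)
next
  case (Neg p)
  show ?case
  proof (cases q)
    case (Neg q1)
    then show ?thesis using Neg.IH[of r q1 r'] Neg.prems by simp
  qed (use Neg.prems in simp_all)
next
  case (Conj p1 p2)
  show ?case
  proof (cases q)
    case (Conj q1 q2)
    with Conj.prems Conj.IH(1)[of "SAnd # str_fm p2 @ SRpar # r" q1 "SAnd # str_fm q2 @ SRpar # r'"]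
      Conj.IH(2)[of "SRpar # r" q2 "SRpar # r'"]
    show ?thesis by simp
  qed (use Conj.prems in \<open>simp_all add: str_tm_neq_str_fm[symmetric]\<close>)
next
  case (Forall x p)
  show ?case
  proof (cases q)
    case (Forall y q1)
    with Forall.prems replicate_prime_cancel[of x "str_fm p @ r" y "str_fm q1 @ r'"]
      Forall.IH[of r q1 r']
    show ?thesis by (simp add: noprime_str_fm)
  qed (use Forall.prems in simp_all)
qed

lemma str_fm_inject: "inj str_fm"
  by (rule injI) (use str_fm_prefix[of _ "[]" _ "[]"] in simp)

abbreviation Imp :: "fm \<Rightarrow> fm \<Rightarrow> fm" where
  "Imp p q \<equiv> Neg (Conj p (Neg q))"

abbreviation Or :: "fm \<Rightarrow> fm \<Rightarrow> fm" where
  "Or p q \<equiv> Neg (Conj (Neg p) (Neg q))"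

abbreviation Exists :: "nat \<Rightarrow> fm \<Rightarrow> fm" where
  "Exists x p \<equiv> Neg (Forall x (Neg p))"

primrec num :: "nat \<Rightarrow> tm" where
  "num 0 = Zero"
| "num (Suc n) = Succ (num n)"

primrec fresh :: "tm \<Rightarrow> nat" where
  "fresh (Var n) = Suc n"
| "fresh Zero = 0"
| "fresh (Succ t) = fresh t"
| "fresh (Add t u) = max (fresh t) (fresh u)"
| "fresh (Mul t u) = max (fresh t) (fresh u)"

text \<open>The bound variable must occur in neither term.\<close>

definition Le :: "tm \<Rightarrow> tm \<Rightarrow> fm" where
  "Le t u = (let z = max (fresh t) (fresh u) in Exists z (Eq (Add (Var z) t) u))"

definition Lt :: "tm \<Rightarrow> tm \<Rightarrow> fm" where
  "Lt t u = Conj (Le t u) (Neg (Eq t u))"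

primrec vars_tm :: "tm \<Rightarrow> nat set" where
  "vars_tm (Var n) = {n}"
| "vars_tm Zero = {}"
| "vars_tm (Succ t) = vars_tm t"
| "vars_tm (Add t u) = vars_tm t \<union> vars_tm u"
| "vars_tm (Mul t u) = vars_tm t \<union> vars_tm u"

primrec fv :: "fm \<Rightarrow> nat set" where
  "fv (Eq t u) = vars_tm t \<union> vars_tm u"
| "fv (Neg p) = fv p"
| "fv (Conj p q) = fv p \<union> fv q"
| "fv (Forall x p) = fv p - {x}"

definition sentence :: "fm \<Rightarrow> bool" where
  "sentence p \<longleftrightarrow> fv p = {}"

primrec subst_tm :: "nat \<Rightarrow> tm \<Rightarrow> tm \<Rightarrow> tm" where
  "subst_tm x s (Var n) = (if n = x then s else Var n)"
| "subst_tm x s Zero = Zero"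
| "subst_tm x s (Succ t) = Succ (subst_tm x s t)"
| "subst_tm x s (Add t u) = Add (subst_tm x s t) (subst_tm x s u)"
| "subst_tm x s (Mul t u) = Mul (subst_tm x s t) (subst_tm x s u)"

text \<open>
  Substitution does not rename bound variables; \<open>free_for x s p\<close> states that no variable
  of \<open>s\<close> is captured when \<open>s\<close> is substituted for \<open>x\<close> in \<open>p\<close>.
\<close>

primrec subst :: "nat \<Rightarrow> tm \<Rightarrow> fm \<Rightarrow> fm" where
  "subst x s (Eq t u) = Eq (subst_tm x s t) (subst_tm x s u)"
| "subst x s (Neg p) = Neg (subst x s p)"
| "subst x s (Conj p q) = Conj (subst x s p) (subst x s q)"
| "subst x s (Forall y p) = (if y = x then Forall y p else Forall y (subst x s p))"

primrec free_for :: "nat \<Rightarrow> tm \<Rightarrow> fm \<Rightarrow> bool" where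
  "free_for x s (Eq t u) \<longleftrightarrow> True"
| "free_for x s (Neg p) \<longleftrightarrow> free_for x s p"
| "free_for x s (Conj p q) \<longleftrightarrow> free_for x s p \<and> free_for x s q"
| "free_for x s (Forall y p) \<longleftrightarrow> x \<notin> fv (Forall y p) \<or> (y \<notin> vars_tm s \<and> free_for x s p)"

primrec prop_eval :: "(fm \<Rightarrow> bool) \<Rightarrow> fm \<Rightarrow> bool" where
  "prop_eval v (Eq t u) \<longleftrightarrow> v (Eq t u)"
| "prop_eval v (Neg p) \<longleftrightarrow> \<not> prop_eval v p"
| "prop_eval v (Conj p q) \<longleftrightarrow> prop_eval v p \<and> prop_eval v q"
| "prop_eval v (Forall x p) \<longleftrightarrow> v (Forall x p)"

definition tautology :: "fm \<Rightarrow> bool" where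
  "tautology p \<longleftrightarrow> (\<forall>v. prop_eval v p)"

text \<open>
  A Hilbert calculus. Generalisation is unrestricted, so an axiom with free variables has
  the same consequences as its universal closure.
\<close>

inductive proves :: "fm set \<Rightarrow> fm \<Rightarrow> bool" (infix \<open>\<turnstile>\<close> 50) for T :: "fm set" where
  Ax: "p \<in> T \<Longrightarrow> T \<turnstile> p"
| Taut: "tautology p \<Longrightarrow> T \<turnstile> p"
| Spec: "free_for x t p \<Longrightarrow> T \<turnstile> Imp (Forall x p) (subst x t p)"
| Distr: "x \<notin> fv p \<Longrightarrow> T \<turnstile> Imp (Forall x (Imp p q)) (Imp p (Forall x q))"
| Refl: "T \<turnstile> Eq t t"
| Cong_Eq: "T \<turnstile> Imp (Conj (Eq t t') (Eq u u')) (Imp (Eq t u) (Eq t' u'))"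
| Cong_Succ: "T \<turnstile> Imp (Eq t t') (Eq (Succ t) (Succ t'))"
| Cong_Add: "T \<turnstile> Imp (Conj (Eq t t') (Eq u u')) (Eq (Add t u) (Add t' u'))"
| Cong_Mul: "T \<turnstile> Imp (Conj (Eq t t') (Eq u u')) (Eq (Mul t u) (Mul t' u'))"
| MP: "T \<turnstile> Imp p q \<Longrightarrow> T \<turnstile> p \<Longrightarrow> T \<turnstile> q"
| Gen: "T \<turnstile> p \<Longrightarrow> T \<turnstile> Forall x p"

definition thms :: "fm set \<Rightarrow> sym list set" where
  "thms T = str_fm ` {p. T \<turnstile> p}"

definition consistent :: "fm set \<Rightarrow> bool" where
  "consistent T \<longleftrightarrow> \<not> (\<exists>p. T \<turnstile> p \<and> T \<turnstile> Neg p)"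

definition extends :: "fm set \<Rightarrow> fm set \<Rightarrow> bool" where
  "extends T U \<longleftrightarrow> (\<forall>p. U \<turnstile> p \<longrightarrow> T \<turnstile> p)"

primrec Disj_le :: "nat \<Rightarrow> nat \<Rightarrow> fm" where
  "Disj_le x 0 = Eq (Var x) (num 0)"
| "Disj_le x (Suc n) = Or (Disj_le x n) (Eq (Var x) (num (Suc n)))"

definition R :: "fm set" where
  "R = {Eq (Add (num m) (num n)) (num (m + n)) | m n. True}
     \<union> {Eq (Mul (num m) (num n)) (num (m * n)) | m n. True}
     \<union> {Neg (Eq (num m) (num n)) | m n. m \<noteq> n}
     \<union> {Imp (Le (Var x) (num n)) (Disj_le x n) | x n. True}
     \<union> {Or (Le (Var x) (num n)) (Le (num n) (Var x)) | x n. True}"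

text \<open>
  \<open>recursive k f\<close>: the restriction of \<open>f\<close> to lists of length \<open>k\<close> is a total
  \<open>\<mu>\<close>-recursive function of \<open>k\<close> arguments. Values on lists of other lengths are irrelevant.
\<close>

inductive recursive :: "nat \<Rightarrow> (nat list \<Rightarrow> nat) \<Rightarrow> bool" where
  zero: "recursive k (\<lambda>xs. 0)"
| succ: "recursive 1 (\<lambda>xs. Suc (xs ! 0))"
| proj: "i < k \<Longrightarrow> recursive k (\<lambda>xs. xs ! i)"
| comp: "recursive (length gs) f \<Longrightarrow> \<forall>g\<in>set gs. recursive k g
    \<Longrightarrow> recursive k (\<lambda>xs. f (map (\<lambda>g. g xs) gs))"
| prec: "recursive k f \<Longrightarrow> recursive (Suc (Suc k)) g
    \<Longrightarrow> recursive (Suc k) (\<lambda>xs. rec_nat (f (tl xs)) (\<lambda>n r. g (n # r # tl xs)) (hd xs))"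
| mu: "recursive (Suc k) f \<Longrightarrow> \<forall>xs. length xs = k \<longrightarrow> (\<exists>n. f (n # xs) = 0)
    \<Longrightarrow> recursive k (\<lambda>xs. LEAST n. f (n # xs) = 0)"

definition re_set :: "nat set \<Rightarrow> bool" where
  "re_set X \<longleftrightarrow> X = {} \<or> (\<exists>f. recursive 1 f \<and> X = range (\<lambda>n. f [n]))"

text \<open>
  Recursive enumerability of sets of strings refers to an effective coding, namely bijective
  base 12; it is unrelated to the arbitrary numberings below.
\<close>

primrec digit :: "sym \<Rightarrow> nat" where
  "digit SZero = 1"
| "digit SSucc = 2"
| "digit SPlus = 3"
| "digit STimes = 4"
| "digit SEq = 5"
| "digit SNot = 6"
| "digit SAnd = 7"
| "digit SAll = 8"
| "digit SVar = 9"
| "digit SPrime = 10"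
| "digit SLpar = 11"
| "digit SRpar = 12"

primrec code :: "sym list \<Rightarrow> nat" where
  "code [] = 0"
| "code (a # s) = digit a + 12 * code s"

definition re_theory :: "fm set \<Rightarrow> bool" where
  "re_theory T \<longleftrightarrow> re_set (code ` str_fm ` T)"

definition numbering :: "(sym list \<Rightarrow> nat) \<Rightarrow> bool" where
  "numbering \<alpha> \<longleftrightarrow> inj_on \<alpha> Astar"

definition quote_fm :: "(sym list \<Rightarrow> nat) \<Rightarrow> fm \<Rightarrow> tm" where
  "quote_fm \<alpha> p = num (\<alpha> (str_fm p))"

text \<open>A formula written \<open>\<phi>(x)\<close> has at most the variable \<open>x\<close>, here \<open>Var 0\<close>, free.\<close>

definition app :: "fm \<Rightarrow> tm \<Rightarrow> fm" where
  "app p t = subst 0 t p"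

definition binumerates :: "fm set \<Rightarrow> fm \<Rightarrow> nat set \<Rightarrow> bool" where
  "binumerates T p X \<longleftrightarrow> fv p \<subseteq> {0} \<and>
     (\<forall>n. (n \<in> X \<longrightarrow> T \<turnstile> app p (num n)) \<and> (n \<notin> X \<longrightarrow> T \<turnstile> Neg (app p (num n))))"

definition Loeb :: "fm set \<Rightarrow> (sym list \<Rightarrow> nat) \<Rightarrow> fm \<Rightarrow> bool" where
  "Loeb T \<alpha> P \<longleftrightarrow> fv P \<subseteq> {0} \<and>
     (\<forall>p q. sentence p \<longrightarrow> sentence q \<longrightarrow>
        (T \<turnstile> p \<longrightarrow> T \<turnstile> app P (quote_fm \<alpha> p)) \<and>
        T \<turnstile> Imp (Conj (app P (quote_fm \<alpha> p)) (app P (quote_fm \<alpha> (Imp p q))))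
              (app P (quote_fm \<alpha> q)) \<and>
        T \<turnstile> Imp (app P (quote_fm \<alpha> p))
              (app P (quote_fm \<alpha> (app P (quote_fm \<alpha> p)))))"

definition Pr :: fm where
  "Pr = Exists 1 (Conj (Lt (Var 1) (Var 0)) (Eq (Var 0) (Mul (num 2) (Var 1))))"

end

theory Submission
  imports Defs "HOL-Library.Countable_Set"
begin

text \<open>
  Since \<open>\<alpha>\<close> need not be computable, it can send the theorems of \<open>T\<close> bijectively onto the positive
  even numbers (\<open>0\<close> does not satisfy \<open>Pr\<close>) and all other strings injectively into the odd numbers.
  As \<open>Pr\<close> binumerates the positive even numbers in \<open>R\<close>, every instance of \<open>Pr\<close> at a quotation
  is decided according to provability, and the Loeb conditions follow by closure of the theorems
  under modus ponens.
\<close>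

text \<open>Each premise is moved into the conclusion as an antecedent and later detached by
  \<open>MP\<close>; with no premises left, \<open>Taut\<close> applies. Propositional steps thus
  reduce to \<open>prop_eval\<close>, with equations and quantified formulas as atoms.\<close>

lemma proves_prop_consequence:
  assumes "\<forall>p\<in>set ps. T \<turnstile> p" and "\<And>v. (\<forall>p\<in>set ps. prop_eval v p) \<Longrightarrow> prop_eval v q"
  shows "T \<turnstile> q"
  using assms
proof (induction ps arbitrary: q)
  case Nil
  then show ?case by (auto intro!: Taut simp: tautology_def)
next
  case (Cons a ps)
  have "T \<turnstile> Imp a q"
    using Cons.prems by (intro Cons.IH) auto
  then show ?case
    using Cons.prems(1) by (auto intro: MP)
qed

lemma proves_Eq_sym: "T \<turnstile> Imp (Eq t u) (Eq u t)"
  by (rule proves_prop_consequence[of "[_, _]", simplified, OF conjI[OF Cong_Eq[of T t u t t] Refl[of T t]]])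
    auto

text \<open>Congruence applied to \<open>Eq u u\<close>: its left side is replaced by
  \<open>t\<close>, its right side by \<open>w\<close>.\<close>

lemma proves_Eq_trans: "T \<turnstile> Imp (Conj (Eq t u) (Eq u w)) (Eq t w)"
  by (rule proves_prop_consequence[of "[Imp (Conj (Eq u t) (Eq u w)) (Imp (Eq u u) (Eq t w)),
        Imp (Eq t u) (Eq u t), Eq u u]"])
    (auto intro: Cong_Eq Refl proves_Eq_sym)

text \<open>Contrapositive of \<open>Spec\<close> for \<open>Neg p\<close>.\<close>

lemma proves_ExistsI:
  assumes "free_for x t p" and "T \<turnstile> subst x t p"
  shows "T \<turnstile> Exists x p"
  by (rule proves_prop_consequence[of "[Imp (Forall x (Neg p)) (subst x t (Neg p)), subst x t p]"])
    (use assms Spec[of x t "Neg p" T] in auto)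

lemma vars_num [simp]: "vars_tm (num n) = {}"
  and fresh_num [simp]: "fresh (num n) = 0"
  and subst_num [simp]: "subst_tm x s (num n) = num n"
  by (induction n) auto

lemma num_inject [simp]: "num m = num n \<longleftrightarrow> m = n"
proof (induction m arbitrary: n)
  case 0
  then show ?case by (cases n) auto
next
  case (Suc m)
  then show ?case by (cases n) auto
qed

lemma R_Add: "R \<turnstile> Eq (Add (num m) (num n)) (num (m + n))"
  and R_Mul: "R \<turnstile> Eq (Mul (num m) (num n)) (num (m * n))"
  and R_neq: "m \<noteq> n \<Longrightarrow> R \<turnstile> Neg (Eq (num m) (num n))"
  and R_Le: "R \<turnstile> Imp (Le (Var x) (num n)) (Disj_le x n)"
  by (auto intro!: Ax simp: R_def)

lemma fv_Pr: "fv Pr = {0}"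
  by (auto simp: Pr_def Lt_def Le_def Let_def)

text \<open>\<open>Le\<close> picks its bound variable from its arguments; \<open>Var 1\<close>
  forces the variable 2 both before and after the substitution, so the two sides agree
  syntactically.\<close>

lemma app_Pr_num:
  "app Pr (num n) = Exists 1 (Conj (Lt (Var 1) (num n)) (Eq (num n) (Mul (num 2) (Var 1))))"
  by (simp add: app_def Pr_def Lt_def Le_def Let_def)

lemma R_app_Pr_num:
  assumes "even n" and "n > 0"
  shows "R \<turnstile> app Pr (num n)"
proof -
  obtain k where k: "n = 2 * k"
    using assms by blast
  \<comment> \<open>The bound variable 2 is inherited from \<open>Le (Var 1) (num n)\<close>;
    \<open>Le (num k) (num n)\<close> would bind 0 instead. The witness works because
    \<open>k + k = n\<close>.\<close>
  have le: "R \<turnstile> Exists 2 (Eq (Add (Var 2) (num k)) (num n))"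
    by (rule proves_ExistsI[where t = "num k"]) (use R_Add[of k k] in \<open>simp_all add: k mult_2\<close>)
  \<comment> \<open>Positivity of \<open>n\<close> separates \<open>k\<close> from
    \<open>2 * k\<close>.\<close>
  have neq: "R \<turnstile> Neg (Eq (num k) (num n))"
    using assms k by (intro R_neq) auto
  have eq: "R \<turnstile> Eq (num n) (Mul (num 2) (num k))"
    using MP[OF proves_Eq_sym R_Mul[of 2 k]] by (simp only: k)
  have "R \<turnstile> Conj (Conj (Exists 2 (Eq (Add (Var 2) (num k)) (num n)))
      (Neg (Eq (num k) (num n)))) (Eq (num n) (Mul (num 2) (num k)))"
    by (rule proves_prop_consequence[of "[_, _, _]", simplified, OF conjI[OF le conjI[OF neq eq]]])
      auto
  then show ?thesis
    unfolding app_Pr_num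
    by (intro proves_ExistsI[where t = "num k"]) (simp_all add: Lt_def Le_def Let_def numeral_2_eq_2)
qed

lemma proves_Disj_le_elim:
  assumes "\<And>k. k \<le> n \<Longrightarrow> T \<turnstile> Imp (Eq (Var x) (num k)) q"
  shows "T \<turnstile> Imp (Disj_le x n) q"
  using assms
proof (induction n)
  case 0
  then show ?case by simp
next
  case (Suc n)
  have "T \<turnstile> Imp (Disj_le x n) q" "T \<turnstile> Imp (Eq (Var x) (num (Suc n))) q"
    using Suc.IH Suc.prems Suc.prems[OF le_refl] by simp_all
  then show ?case
    by (intro proves_prop_consequence[of
          "[Imp (Disj_le x n) q, Imp (Eq (Var x) (num (Suc n))) q]"]) auto
qed

text \<open>The bound on \<open>Var 1\<close> leaves finitely many candidates \<open>k\<close> for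
  half of \<open>n\<close>, and each is refuted separately.\<close>

lemma R_Neg_app_Pr_num:
  assumes "\<not> (even n \<and> n > 0)"
  shows "R \<turnstile> Neg (app Pr (num n))"
proof -
  let ?body = "Conj (Lt (Var 1) (num n)) (Eq (num n) (Mul (num 2) (Var 1)))"
  have "R \<turnstile> Imp (Eq (Var 1) (num k)) (Neg ?body)" for k
  proof (cases "n = 2 * k")
    case True
    \<comment> \<open>Here \<open>n\<close> is even, hence 0, and so is \<open>k\<close>; the
      inequality inside \<open>Lt\<close> then fails propositionally.\<close>
    then have "n = k"
      using assms by auto
    then show ?thesis
      by (intro Taut) (auto simp: tautology_def Lt_def)
  next
    case False
    \<comment> \<open>Congruence and transitivity carry the body to
      \<open>Eq (num n) (num (2 * k))\<close>, which an axiom of \<open>R\<close> refutes.\<close>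
    let ?ps = "[Imp (Conj (Eq (num 2) (num 2)) (Eq (Var 1) (num k)))
        (Eq (Mul (num 2) (Var 1)) (Mul (num 2) (num k))),
      Eq (num 2) (num 2),
      Imp (Conj (Eq (num n) (Mul (num 2) (Var 1))) (Eq (Mul (num 2) (Var 1)) (Mul (num 2) (num k))))
        (Eq (num n) (Mul (num 2) (num k))),
      Imp (Conj (Eq (num n) (Mul (num 2) (num k))) (Eq (Mul (num 2) (num k)) (num (2 * k))))
        (Eq (num n) (num (2 * k))),
      Eq (Mul (num 2) (num k)) (num (2 * k)),
      Neg (Eq (num n) (num (2 * k)))]"
    have "\<forall>p\<in>set ?ps. R \<turnstile> p"
      using Cong_Mul Refl proves_Eq_trans R_Mul R_neq[OF False] by simp
    then show ?thesis
      by (rule proves_prop_consequence) auto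
  qed
  then have "R \<turnstile> Imp (Disj_le 1 n) (Neg ?body)"
    by (rule proves_Disj_le_elim)
  then have "R \<turnstile> Neg ?body"
    by (intro proves_prop_consequence[of
          "[Imp (Disj_le 1 n) (Neg ?body), Imp (Le (Var 1) (num n)) (Disj_le 1 n)]"])
      (auto simp: R_Le Lt_def)
  then have "R \<turnstile> Forall 1 (Neg ?body)"
    by (rule Gen)
  then show ?thesis
    unfolding app_Pr_num
    by (intro proves_prop_consequence[of "[Forall 1 (Neg ?body)]"]) auto
qed

text \<open>Digits range over 1 to 12, so the residue modulo 12 determines the first symbol, and
  only the empty string has code 0.\<close>

lemma inj_code: "inj code"
proof (rule injI)
  have digit: "1 \<le> digit a" "digit a \<le> 12" "digit a = digit b \<Longrightarrow> a = b" for a b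
    by (cases a; cases b; simp)+
  show "s = t" if "code s = code t" for s t
    using that
  proof (induction s arbitrary: t)
    case Nil
    then show ?case using digit(1)[of "hd t"] by (cases t) auto
  next
    case (Cons a s)
    then obtain b t' where t: "t = b # t'"
      using digit(1)[of a] by (cases t) auto
    with Cons.prems have "digit a + 12 * code s = digit b + 12 * code t'"
      by simp
    with digit(1,2)[of a] digit(1,2)[of b] have "digit a = digit b" "code s = code t'"
      by presburger+
    then show ?case
      using Cons.IH digit(3) t by blast
  qed
qed

lemma infinite_thms: "infinite (thms T)"
proof -
  have "inj (\<lambda>n. str_fm (Eq (num n) (num n)))"
    by (rule injI) (use injD[OF str_fm_inject] in fastforce)
  moreover have "range (\<lambda>n. str_fm (Eq (num n) (num n))) \<subseteq> thms T"
    by (auto simp: thms_def simp del: str_fm.simps intro: Refl)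
  ultimately show ?thesis
    by (meson finite_subset infinite_UNIV_nat finite_imageD)
qed

lemma str_fm_in_thms [simp]: "str_fm p \<in> thms T \<longleftrightarrow> T \<turnstile> p"
  using str_fm_inject by (auto simp: thms_def inj_def)

lemma ex_numbering_even_iff_thms:
  "\<exists>\<alpha> :: sym list \<Rightarrow> nat. inj \<alpha> \<and> (\<forall>s. even (\<alpha> s) \<longleftrightarrow> s \<in> thms T) \<and>
    \<alpha> ` thms T = {n. even n \<and> n > 0}"
proof -
  define g where "g = to_nat_on (thms T)"
  have "countable (thms T)"
    using inj_code by (auto intro: countableI[of code] inj_on_subset)
  then have g: "bij_betw g (thms T) UNIV"
    unfolding g_def using infinite_thms by (rule to_nat_on_infinite)
  \<comment> \<open>\<open>Suc\<close> skips the value 0, where \<open>Pr\<close> is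
    refutable.\<close>
  define \<alpha> where "\<alpha> s = (if s \<in> thms T then 2 * Suc (g s) else 2 * code s + 1)" for s
  have even: "even (\<alpha> s) \<longleftrightarrow> s \<in> thms T" for s
    by (simp add: \<alpha>_def)
  have "inj \<alpha>"
  proof (rule injI)
    \<comment> \<open>Parity reveals which branch of \<open>\<alpha>\<close> was taken, so
      injectivity is checked branch by branch.\<close>
    fix s t assume eq: "\<alpha> s = \<alpha> t"
    then have iff: "s \<in> thms T \<longleftrightarrow> t \<in> thms T"
      using even by metis
    show "s = t"
    proof (cases "s \<in> thms T")
      case True
      with eq iff g show ?thesis by (auto simp: \<alpha>_def bij_betw_def inj_on_def)
    next
      case False
      with eq iff inj_code show ?thesis by (auto simp: \<alpha>_def inj_def)
    qed
  qed
  moreover have "\<alpha> ` thms T = {n. even n \<and> n > 0}"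
  proof -
    have "\<alpha> ` thms T = (\<lambda>k. 2 * Suc k) ` g ` thms T"
      unfolding image_image by (intro image_cong) (auto simp: \<alpha>_def)
    also have "\<dots> = range (\<lambda>k. 2 * Suc k)"
      using g by (simp add: bij_betw_def)
    also have "\<dots> = {n. even n \<and> n > 0}"
    proof (intro equalityI subsetI)
      fix n :: nat assume "n \<in> {n. even n \<and> n > 0}"
      \<comment> \<open>Truncated subtraction is harmless: a positive even \<open>n\<close> has
        \<open>n div 2\<close> at least 1.\<close>
      then have "n = 2 * Suc (n div 2 - 1)"
        by auto
      then show "n \<in> range (\<lambda>k. 2 * Suc k)"
        by (rule range_eqI)
    qed auto
    finally show ?thesis .
  qed
  ultimately show ?thesis
    using even by blast
qed

theorem mainTheorem2:
  fixes T :: "fm set" and bot :: fm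
  assumes "consistent T"
    and "re_theory T"
    and "extends T R"
    and "sentence bot" and "T \<turnstile> Neg bot"
  shows "\<exists>\<alpha>. numbering \<alpha> \<and>
    (\<forall>s\<in>Astar. even (\<alpha> s) \<longleftrightarrow> s \<in> thms T) \<and>
    binumerates R Pr (\<alpha> ` thms T) \<and>
    Loeb T \<alpha> Pr \<and>
    T \<turnstile> Neg (app Pr (quote_fm \<alpha> bot))"
proof -
  obtain \<alpha> :: "sym list \<Rightarrow> nat" where \<alpha>: "inj \<alpha>" "\<forall>s. even (\<alpha> s) \<longleftrightarrow> s \<in> thms T"
    "\<alpha> ` thms T = {n. even n \<and> n > 0}"
    using ex_numbering_even_iff_thms[of T] by blast
  have bin: "binumerates R Pr (\<alpha> ` thms T)"
    unfolding binumerates_def \<alpha>(3) using R_app_Pr_num R_Neg_app_Pr_num by (auto simp: fv_Pr)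
  have mem: "\<alpha> (str_fm p) \<in> \<alpha> ` thms T \<longleftrightarrow> T \<turnstile> p" for p
    using inj_image_mem_iff[OF \<alpha>(1)] by simp
  have pos: "T \<turnstile> app Pr (quote_fm \<alpha> p)" if "T \<turnstile> p" for p
    using bin that assms(3) mem[of p] by (simp add: binumerates_def extends_def quote_fm_def)
  \<comment> \<open>Unprovability yields a refutation already in \<open>R\<close>, which
    \<open>T\<close> inherits.\<close>
  have neg: "T \<turnstile> Neg (app Pr (quote_fm \<alpha> p))" if "\<not> T \<turnstile> p" for p
    using bin that assms(3) mem[of p] by (simp add: binumerates_def extends_def quote_fm_def)
  have "T \<turnstile> Imp (Conj (app Pr (quote_fm \<alpha> p)) (app Pr (quote_fm \<alpha> (Imp p q))))
      (app Pr (quote_fm \<alpha> q))" for p q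
  proof -
    \<comment> \<open>If the conclusion is unprovable, so is one of the premises, and its
      \<open>Pr\<close> instance is refuted.\<close>
    consider "\<not> T \<turnstile> p" | "\<not> T \<turnstile> Imp p q" | "T \<turnstile> q"
      using MP by blast
    then show ?thesis
    proof cases
      case 1
      show ?thesis
        by (rule proves_prop_consequence[of "[Neg (app Pr (quote_fm \<alpha> p))]"]) (use neg[OF 1] in auto)
    next
      case 2
      show ?thesis
        by (rule proves_prop_consequence[of "[Neg (app Pr (quote_fm \<alpha> (Imp p q)))]"])
          (use neg[OF 2] in auto)
    next
      case 3
      show ?thesis
        by (rule proves_prop_consequence[of "[app Pr (quote_fm \<alpha> q)]"]) (use pos[OF 3] in auto)
    qed
  qed
  moreover have "T \<turnstile> Imp (app Pr (quote_fm \<alpha> p)) (app Pr (quote_fm \<alpha> (app Pr (quote_fm \<alpha> p))))" for p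
  proof (cases "T \<turnstile> p")
    case True
    show ?thesis
      by (rule proves_prop_consequence[of "[app Pr (quote_fm \<alpha> (app Pr (quote_fm \<alpha> p)))]"])
        (use pos[OF pos[OF True]] in auto)
  next
    case False
    show ?thesis
      by (rule proves_prop_consequence[of "[Neg (app Pr (quote_fm \<alpha> p))]"]) (use neg[OF False] in auto)
  qed
  ultimately have "Loeb T \<alpha> Pr"
    unfolding Loeb_def using pos by (simp add: fv_Pr)
  \<comment> \<open>Consistency and \<open>T \<turnstile> Neg bot\<close> make \<open>bot\<close>
    unprovable.\<close>
  moreover have "T \<turnstile> Neg (app Pr (quote_fm \<alpha> bot))"
    using assms neg unfolding consistent_def by blast
  moreover have "numbering \<alpha>"
    unfolding numbering_def using \<alpha>(1) by (rule inj_on_subset) simp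
  ultimately show ?thesis
    using \<alpha>(2) bin by blast
qed

end
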